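(* Consider the Circa auction described in the context, with compliance price $p_\epsilon\in(0,1)$. Let $F$ be the cumulative distribution function of the random premium reward $v_i^p=V_i\lambda_i$, with $F(v_i^p)>0$ for $v_i^p>0$. Then agents participating in the auction follow the optimal (symmetric Nash equilibrium) bidding strategy $$\hat b_i^*:=p_\epsilon+v_i^pF(v_i^p)-\int_0^{v_i^p}F(z)\,dz\;>\;p_\epsilon ,$$ that is: if every rival agent $j$ bids by the same formula in terms of $v_j^p$, then for every participating agent $i$ the bid $\hat b_i^*$ maximizes its expected utility, and $\hat b_i^*>p_\epsilon$. The utility attained is $$u_i(\hat b_i^*;\boldsymbol b_{-i},v_i^d,v_i^p)=v_i^d-p_\epsilon+\int_0^{v_i^p}F(z)\,dz .$$
   Context: Circa auction. A regulator fixes a compliance threshold whose price is $p_\epsilon\in(0,1)$. Each agent $i$ has a private total value $V_i$ drawn from a distribution $\mathcal D_V$ on $[0,1]$ and a private scaling factor $\lambda_i$ drawn from a distribution $\mathcal D_\lambda$ on $[0,1/2]$ (any such distributions are allowed); the distributions are common knowledge. The deployment value is $v_i^d=(1-\lambda_i)V_i$ and the premium value is $v_i^p=\lambda_iV_i\in[0,1/2]$. Agent $i$ chooses a bid $b\in[0,1]$, which is a sunk cost. It is paired with one randomly chosen rival $j$ (among participating agents), whose premium value $v_j^p$ is, from agent $i$'s viewpoint, distributed according to $F$. If $b_j$ is the rival's bid and $\boldsymbol b_{-i}$ denotes the bids of all agents other than $i$, agent $i$'s realized utility is $$u_i(b;\boldsymbol b_{-i},v_i^d,v_i^p)=\begin{cases}-b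 & \text{if } b<p_\epsilon,\\ v_i^d-b & \text{if } b\ge p_\epsilon \text{ and } b<b_j,\\ v_i^d+v_i^p-b & \text{if } b\ge p_\epsilon\text{ and } b>b_j,\end{cases}$$ and a bid $b=1$ automatically wins, i.e. yields $v_i^d+v_i^p-1$. "Utility" of a bid means the expectation of this quantity over the random rival, with agent $i$'s own $v_i^d,v_i^p$ fixed. Bidding $0$ means not participating and gives utility $0$. An agent participates exactly when some bid gives it strictly positive (expected) utility.
   Formalization: The strict inequality (bid > p_ε) is claimed only if v_i^p > 0 and F(0) = 0 or F(0) < F(v_i^p); otherwise the bid equals p_ε (e.g. λ_i = 0, V_i > p_ε). Ties b = b_j, whose payoff is left undefined, count as wins. *)

theory Defs
  imports "HOL-Probability.Probability"
begin

text \<open>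
  Realized utility of a bid \<open>b\<close> against a rival's bid \<open>bj\<close>, for threshold price \<open>p\<close>,
  deployment value \<open>vd\<close> and premium value \<open>vp\<close>.  A tie \<open>b = bj\<close> is resolved in favour of
  the bidder.  This only matters when premium values have atoms; for atomless laws, ties
  under the bidding rule \<open>circa_bid\<close> below have probability zero.
\<close>
definition realized_utility :: "real \<Rightarrow> real \<Rightarrow> real \<Rightarrow> real \<Rightarrow> real \<Rightarrow> real" where
  "realized_utility p vd vp b bj =
     (if b < p then - b
      else if b = 1 then vd + vp - 1
      else if b < bj then vd - b
      else vd + vp - b)"

text \<open>
  \<open>G\<close> is the law of the rival's premium value and \<open>\<beta>\<close> the rival's strategy, a function of that
  value.
\<close>
definition expected_utility ::
  "real measure \<Rightarrow> (real \<Rightarrow> real) \<Rightarrow> real \<Rightarrow> real \<Rightarrow> real \<Rightarrow> real \<Rightarrow> real" where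
  "expected_utility G \<beta> p vd vp b = (\<integral>z. realized_utility p vd vp b (\<beta> z) \<partial>G)"

definition participates ::
  "real measure \<Rightarrow> (real \<Rightarrow> real) \<Rightarrow> real \<Rightarrow> real \<Rightarrow> real \<Rightarrow> bool" where
  "participates G \<beta> p vd vp \<longleftrightarrow> (\<exists>b\<in>{0..1}. expected_utility G \<beta> p vd vp b > 0)"

definition circa_bid :: "(real \<Rightarrow> real) \<Rightarrow> real \<Rightarrow> real \<Rightarrow> real" where
  "circa_bid F p v = p + v * F v - integral {0..v} F"

end

theory Submission imports Defs begin

text \<open>
  Write \<open>\<Phi> v\<close> for the integral of \<open>F\<close> over \<open>[0, v]\<close>. As \<open>F\<close> is monotone, \<open>\<Phi>\<close> is convex with
  subgradient \<open>F\<close>, i.e. \<open>(w - y) F y \<le> \<Phi> w - \<Phi> y\<close>. Since \<open>\<beta> y = p + y F y - \<Phi> y\<close>, this says that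
  an agent of premium value \<open>w\<close> does not gain by bidding \<open>\<beta> y\<close> instead of \<open>\<beta> w\<close>; it also shows that
  \<open>\<beta>\<close> is monotone, and constant only where \<open>F\<close> is, so that a bid \<open>\<beta> y\<close> wins with probability exactly
  \<open>F y\<close>, even when the law of the premium value has atoms.
\<close>

text \<open>A down-closed set of reals is empty, the whole line, \<open>{..s}\<close> or
  \<open>{..<s}\<close> with \<open>s = Sup S\<close>. Its mass is then 0, the limit of the cdf at
  infinity, its value at \<open>s\<close>, or its left limit there.\<close>

lemma (in real_distribution) measure_down_closed_le:
  assumes down: "\<And>x y. y \<in> S \<Longrightarrow> x \<le> y \<Longrightarrow> x \<in> S"
    and le: "\<And>y. y \<in> S \<Longrightarrow> cdf M y \<le> c" and "0 \<le> c"
  shows "measure M S \<le> c"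
proof (cases "S = {} \<or> S = UNIV")
  case True
  moreover have "measure M UNIV \<le> c" if "S = UNIV"
  proof -
    have "1 \<le> c"
      by (rule tendsto_upperbound[OF cdf_lim_at_top_prob]) (auto simp: le that)
    then show ?thesis using prob_space by simp
  qed
  ultimately show ?thesis using \<open>0 \<le> c\<close> by auto
next
  case False
  then obtain u where u: "u \<notin> S" by blast
  then have ub: "x \<le> u" if "x \<in> S" for x
    using down[OF that, of u] by (meson linear)
  then have bdd: "bdd_above S" by (auto simp: bdd_above_def)
  have below: "x \<in> S" if "x < Sup S" for x
    using that down False by (meson less_cSupD less_imp_le)
  show ?thesis
  proof (cases "Sup S \<in> S")
    case True
    then have "S = {..Sup S}"
      using below cSup_upper[OF _ bdd] by (auto intro: down)
    then have "measure M S = cdf M (Sup S)" by (metis cdf_def2)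
    then show ?thesis using le True by simp
  next
    case False
    then have "S = {..<Sup S}"
      using below cSup_upper[OF _ bdd] by (auto simp: less_le)
    moreover have "measure M {..<Sup S} \<le> c"
      by (rule tendsto_upperbound[OF cdf_at_left])
        (auto simp: eventually_at_filter le below)
    ultimately show ?thesis by simp
  qed
qed

locale circa_auction = real_distribution G for G :: "real measure" +
  fixes p :: real
  assumes cdf_neg: "v < 0 \<Longrightarrow> cdf G v = 0"
begin

abbreviation "F \<equiv> cdf G"
abbreviation "\<beta> \<equiv> circa_bid F p"

lemma cdf_le_1: "F v \<le> 1"
  by (simp add: cdf_bounded_prob)

lemma cdf_integrable: "F integrable_on {a..b}"
  by (rule integrable_on_mono_on) (auto intro: mono_onI cdf_nondecreasing)

lemma integral_cdf_ge_tangent: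
  assumes "0 \<le> y" "0 \<le> w"
  shows "(w - y) * F y \<le> integral {0..w} F - integral {0..y} F"
proof (cases "y \<le> w")
  case True
  have "integral {y..w} (\<lambda>_. F y) \<le> integral {y..w} F"
    by (rule integral_le) (auto intro: cdf_integrable cdf_nondecreasing)
  moreover have "integral {0..y} F + integral {y..w} F = integral {0..w} F"
    using assms True by (intro Henstock_Kurzweil_Integration.integral_combine cdf_integrable)
  ultimately show ?thesis using True by simp
next
  case False
  have "integral {w..y} F \<le> integral {w..y} (\<lambda>_. F y)"
    by (rule integral_le) (auto intro: cdf_integrable cdf_nondecreasing)
  moreover have "integral {0..w} F + integral {w..y} F = integral {0..y} F"
    using assms False by (intro Henstock_Kurzweil_Integration.integral_combine cdf_integrable) auto
  ultimately show ?thesis using False by (simp add: algebra_simps)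
qed

text \<open>This is the tangent inequality with base point \<open>y\<close> taken at
  \<open>x\<close>; the terms \<open>y * F y\<close> cancel.\<close>

lemma bid_diff_ge:
  assumes "0 \<le> x" "0 \<le> y"
  shows "x * (F y - F x) \<le> \<beta> y - \<beta> x"
  using integral_cdf_ge_tangent[of y x] assms by (simp add: circa_bid_def algebra_simps)

text \<open>For \<open>v < 0\<close> both the interval \<open>{0..v}\<close> and the mass below
  \<open>v\<close> vanish, so \<beta> extends as a constant and is monotone on the whole
  line.\<close>

lemma bid_nonpos: "v \<le> 0 \<Longrightarrow> \<beta> v = p"
  by (cases "v = 0") (auto simp: circa_bid_def cdf_neg)

lemma mono_bid: "mono \<beta>"
proof (rule monoI)
  fix x y :: real assume "x \<le> y"
  consider "y \<le> 0" | "x \<le> 0" "0 \<le> y" | "0 \<le> x" using \<open>x \<le> y\<close> by linarith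
  then show "\<beta> x \<le> \<beta> y"
  proof cases
    case 1 then show ?thesis using \<open>x \<le> y\<close> by (simp add: bid_nonpos)
  next
    case 2 then show ?thesis using bid_diff_ge[of 0 y] by (simp add: bid_nonpos)
  next
    case 3
    then have "0 \<le> x * (F y - F x)" using \<open>x \<le> y\<close> by (simp add: cdf_nondecreasing)
    then show ?thesis using bid_diff_ge[of x y] 3 \<open>x \<le> y\<close> by simp
  qed
qed

lemma bid_ge: "p \<le> \<beta> v"
  using monoD[OF mono_bid, of "min v 0" v] by (simp add: bid_nonpos)

lemma bid_measurable [measurable]: "\<beta> \<in> borel_measurable borel"
  by (rule borel_measurable_mono[OF mono_bid])

lemma bid_strict:
  assumes "0 \<le> x" "F x < F y"
  shows "\<beta> x < \<beta> y"
proof -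
  have "x < y" using assms(2) cdf_nondecreasing[of y x] by linarith
  \<comment> \<open>For \<open>x = 0\<close> the bound of \<open>bid_diff_ge\<close> degenerates, so it is applied at a point slightly to the
    right, where by right continuity \<open>F\<close> is still below \<open>F y\<close>.\<close>
  have "eventually (\<lambda>z. F z < F y) (at_right x)"
    using cdf_is_right_cont[of x] assms(2) by (auto simp: continuous_within intro: order_tendstoD)
  moreover have "eventually (\<lambda>z. z \<in> {x<..<y}) (at_right x)"
    using \<open>x < y\<close> by (rule eventually_at_right_real)
  ultimately have "eventually (\<lambda>z. F z < F y \<and> z \<in> {x<..<y}) (at_right x)"
    by (rule eventually_conj)
  then obtain z where z: "F z < F y" "x < z" "z < y"
    using eventually_happens'[of "at_right x"] by (auto simp: trivial_limit_at_right_real)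
  have "0 < z * (F y - F z)" using z assms(1) by simp
  also have "\<dots> \<le> \<beta> y - \<beta> z" using z assms(1) by (intro bid_diff_ge) auto
  finally show ?thesis using monoD[OF mono_bid, of x z] z by simp
qed

lemma win_prob_le:
  assumes "\<And>y. 0 \<le> y \<Longrightarrow> \<beta> y \<le> b \<Longrightarrow> F y \<le> c" and "0 \<le> c"
  shows "measure G {z. \<beta> z \<le> b} \<le> c"
proof (rule measure_down_closed_le)
  show "x \<in> {z. \<beta> z \<le> b}" if "y \<in> {z. \<beta> z \<le> b}" "x \<le> y" for x y
    using that monoD[OF mono_bid, of x y] by simp
  show "F y \<le> c" if "y \<in> {z. \<beta> z \<le> b}" for y
    using that assms by (cases "0 \<le> y") (auto simp: cdf_neg)
qed fact

text \<open>Ties count as wins, so all rivals up to \<open>v\<close> are beaten. A rival above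
  \<open>v\<close> with the same bid has the same value of \<open>F\<close> by
  \<open>bid_strict\<close>, hence adds no mass.\<close>

lemma win_prob_bid:
  assumes "0 \<le> v"
  shows "measure G {z. \<beta> z \<le> \<beta> v} = F v"
proof (rule antisym)
  show "measure G {z. \<beta> z \<le> \<beta> v} \<le> F v"
    using bid_strict[OF assms] by (intro win_prob_le cdf_nonneg) (meson not_le)
  show "F v \<le> measure G {z. \<beta> z \<le> \<beta> v}"
    using monoD[OF mono_bid, of _ v] by (subst cdf_def2, intro finite_measure_mono) auto
qed

text \<open>A deviation \<open>b\<close> need not be a value of \<beta>, whose range has gaps where
  the law has atoms at positive points. The tangent inequality is therefore applied to every
  \<open>y\<close> whose bid is at most \<open>b\<close>.\<close>

lemma win_prob_bound:
  assumes "0 \<le> v" "p \<le> b"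
  shows "v * measure G {z. \<beta> z \<le> b} \<le> b - p + integral {0..v} F"
proof (cases "v = 0")
  case True
  then show ?thesis using assms by simp
next
  case False
  then have v: "0 < v" using assms by simp
  have nn: "0 \<le> integral {0..v} F"
    by (rule integral_nonneg) (auto intro: cdf_integrable cdf_nonneg)
  \<comment> \<open>Division by \<open>v\<close> gives a bound on \<open>F y\<close> that is uniform
    in \<open>y\<close>, as \<open>win_prob_le\<close> requires.\<close>
  have "measure G {z. \<beta> z \<le> b} \<le> (b - p + integral {0..v} F) / v"
  proof (rule win_prob_le)
    fix y assume y: "0 \<le> y" "\<beta> y \<le> b"
    have "v * F y \<le> \<beta> y - p + integral {0..v} F"
      using integral_cdf_ge_tangent[of y v] y v by (simp add: circa_bid_def algebra_simps)
    then show "F y \<le> (b - p + integral {0..v} F) / v"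
      using y v by (simp add: field_simps)
  qed (use nn v assms in simp)
  then show ?thesis using v by (simp add: field_simps)
qed

lemma utility_below: "b < p \<Longrightarrow> expected_utility G \<beta> p vd vp b = - b"
  using prob_space by (simp add: expected_utility_def realized_utility_def)

lemma utility_one: "p < 1 \<Longrightarrow> expected_utility G \<beta> p vd vp 1 = vd + vp - 1"
  using prob_space by (simp add: expected_utility_def realized_utility_def)

lemma utility_between:
  assumes "p \<le> b" "b < 1"
  shows "expected_utility G \<beta> p vd vp b = vd - b + vp * measure G {z. \<beta> z \<le> b}"
proof -
  have [measurable]: "{z. \<beta> z \<le> b} \<in> sets G" by simp
  have "realized_utility p vd vp b (\<beta> z) = vd - b + vp * indicator {z. \<beta> z \<le> b} z" for z
    using assms by (auto simp: realized_utility_def indicator_def)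
  moreover have "integrable G (indicator {z. \<beta> z \<le> b} :: real \<Rightarrow> real)"
    by (rule integrable_real_indicator) (simp_all add: emeasure_eq_measure)
  ultimately show ?thesis
    using prob_space by (simp add: expected_utility_def Bochner_Integration.integral_add)
qed

lemma equilibrium:
  assumes p: "0 < p" "p < 1" and vp: "0 \<le> vp" and total: "vd + vp \<le> 1"
    and part: "participates G \<beta> p vd vp"
  shows "is_arg_max (expected_utility G \<beta> p vd vp) (\<lambda>b. b \<in> {0..1}) (\<beta> vp)"
    and "expected_utility G \<beta> p vd vp (\<beta> vp) = vd - p + integral {0..vp} F"
proof -
  let ?U = "expected_utility G \<beta> p vd vp" and ?m = "vd - p + integral {0..vp} F"
  have mid: "?U b \<le> ?m" if "p \<le> b" "b < 1" for b
    using win_prob_bound[OF vp that(1)] utility_between[OF that] by simp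
  \<comment> \<open>Positive utility is thus possible only for bids in \<open>[p, 1)\<close>, where
    \<open>mid\<close> applies; so participation forces \<open>?m\<close> to be positive.\<close>
  have outer: "?U b \<le> 0" if "b \<in> {0..1}" "\<not> (p \<le> b \<and> b < 1)" for b
    using that p total utility_below[of b] utility_one by (cases "b < p") auto
  obtain b0 where "b0 \<in> {0..1}" "0 < ?U b0" using part by (auto simp: participates_def)
  then have pos: "0 < ?m" using mid outer by (meson less_le_trans not_le)
  \<comment> \<open>The utility formula would fail at the bid \<open>1\<close>, which always wins; a participant never bids that high.\<close>
  have "\<beta> vp < vd + vp * F vp" using pos by (simp add: circa_bid_def)
  also have "\<dots> \<le> vd + vp" using vp cdf_le_1 by (simp add: mult_left_le)
  finally have lt1: "\<beta> vp < 1" using total by simp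
  show eq: "?U (\<beta> vp) = ?m"
    using utility_between[OF bid_ge lt1] win_prob_bid[OF vp] by (simp add: circa_bid_def)
  have "?U b \<le> ?U (\<beta> vp)" if "b \<in> {0..1}" for b
    using mid[of b] outer[OF that] pos eq by fastforce
  then show "is_arg_max ?U (\<lambda>b. b \<in> {0..1}) (\<beta> vp)"
    using lt1 bid_ge[of vp] p by (simp add: is_arg_max_linorder)
qed

end

theorem theorem2:
  fixes M :: "'w measure" and V L :: "'w \<Rightarrow> real" and p :: real
    and Vi li vd vp :: real and G :: "real measure" and F \<beta> :: "real \<Rightarrow> real"
  assumes M: "prob_space M"
    and V: "V \<in> borel_measurable M" "AE \<omega> in M. V \<omega> \<in> {0..1}"
    and L: "L \<in> borel_measurable M" "AE \<omega> in M. L \<omega> \<in> {0..1/2}"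
    and p: "0 < p" "p < 1"
    and G_def: "G = distr M borel (\<lambda>\<omega>. V \<omega> * L \<omega>)"
    and F_def: "F = cdf G"
    and F_pos: "\<And>v. 0 < v \<Longrightarrow> 0 < F v"
    and \<beta>_def: "\<beta> = circa_bid F p"
    and agent: "Vi \<in> {0..1}" "li \<in> {0..1/2}"
    and vd_def: "vd = (1 - li) * Vi"
    and vp_def: "vp = li * Vi"
    and part: "participates G \<beta> p vd vp"
  shows "is_arg_max (expected_utility G \<beta> p vd vp) (\<lambda>b. b \<in> {0..1}) (\<beta> vp)
    \<and> (0 < vp \<and> (F 0 = 0 \<or> F 0 < F vp) \<longrightarrow> \<beta> vp > p)
    \<and> expected_utility G \<beta> p vd vp (\<beta> vp) = vd - p + integral {0..vp} F"
proof -
  interpret M: prob_space M by (rule M)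
  have [measurable]: "V \<in> borel_measurable M" "L \<in> borel_measurable M" by fact+
  have nn: "AE \<omega> in M. 0 \<le> V \<omega> * L \<omega>"
    using V(2) L(2) by eventually_elim simp
  interpret real_distribution G
    unfolding G_def by (rule M.real_distribution_distr) measurable
  interpret circa_auction G p
  proof
    fix v :: real assume "v < 0"
    have "cdf G v = M.prob {\<omega> \<in> space M. V \<omega> * L \<omega> \<le> v}"
      by (simp add: cdf_def2 G_def measure_distr vimage_def Int_def conj_commute)
    also have "\<dots> = 0"
    proof (rule M.prob_eq_0_AE)
      show "AE \<omega> in M. \<not> V \<omega> * L \<omega> \<le> v"
        using nn by eventually_elim (use \<open>v < 0\<close> in linarith)
    qed
    finally show "cdf G v = 0" .
  qed
  have vp: "0 \<le> vp" using agent by (simp add: vp_def)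
  have total: "vd + vp \<le> 1" using agent by (simp add: vd_def vp_def algebra_simps)
  \<comment> \<open>The bid at 0 is \<open>p\<close>. If 0 carries an atom and \<open>F\<close> is
    constant on \<open>[0, vp]\<close>, then the bid at \<open>vp\<close> is also \<open>p\<close>;
    the second premise excludes this.\<close>
  have "p < \<beta> vp" if "0 < vp" "F 0 = 0 \<or> F 0 < F vp"
    using bid_strict[of 0 vp] bid_nonpos[of 0] that F_pos[OF that(1)]
    unfolding \<beta>_def F_def by auto
  then show ?thesis
    using equilibrium[OF p vp total] part unfolding \<beta>_def F_def by blast
qed

end
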